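(* Let $\mathcal H$ be a complex Hilbert space (of arbitrary dimension), let $T$ be a bounded operator on $\mathcal H$ with $W(T)\subset\mathcal S_{\pi/4}=\{re^{i\theta}:r\ge0,\ |\theta|\le\pi/4\}$, and put $$w=(T^2-I)(T^2+I)^{-1},\qquad b_\gamma(z)=\frac{z-\gamma}{1-\bar\gamma z},\qquad \kappa_0=\frac{276889}{127200}-\frac{6103\sqrt2}{10600}.$$ If $\alpha,\beta\in\mathbb C$ satisfy $|\alpha|,|\beta|\le\frac1{150}$, then $$\|b_\alpha(w)b_\beta(w)\|\le\frac{\kappa_0+2\sqrt2/150+1/150^2}{1-2\sqrt2/150-\kappa_0/150^2}<\sqrt2 .$$ In particular, this applies to $\alpha=1/150$, $\beta=i/150$, which give two distinct nonzero zeros on the boundary of the parameter bidisk $\{|\alpha|,|\beta|\le 1/150\}$.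
   Context: $W(T)=\{\langle Tx,x\rangle:\|x\|=1\}$ is the numerical range and $\|\cdot\|$ is the operator norm; $b_\gamma(w)=(w-\gamma I)(I-\bar\gamma w)^{-1}$. *)

theory Defs
  imports "HOL-Analysis.Analysis"
begin

section \<open>Complex Hilbert spaces\<close>

text \<open>
  The distribution only has real inner product spaces.  A complex inner product space is
  taken here as a real one (so that norm, topology and bounded linear maps are the library's)
  carrying in addition a complex scalar multiplication that extends the real one, and a
  sesquilinear form, linear in the first argument, whose real part is the real inner product.
  Positive definiteness of the form and \<open>norm x = sqrt (Re (cinner x x))\<close> are inherited
  from the axioms of \<^class>\<open>real_inner\<close>.
\<close>

class complex_inner = real_inner +
  fixes scaleC :: "complex \<Rightarrow> 'a \<Rightarrow> 'a"  (infixr "*\<^sub>C" 75)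
    and cinner :: "'a \<Rightarrow> 'a \<Rightarrow> complex"
  assumes scaleC_add_right: "c *\<^sub>C (x + y) = c *\<^sub>C x + c *\<^sub>C y"
    and scaleC_add_left: "(c + d) *\<^sub>C x = c *\<^sub>C x + d *\<^sub>C x"
    and scaleC_scaleC: "c *\<^sub>C d *\<^sub>C x = (c * d) *\<^sub>C x"
    and scaleR_scaleC: "r *\<^sub>R x = complex_of_real r *\<^sub>C x"
    and cinner_commute: "cinner x y = cnj (cinner y x)"
    and cinner_add_left: "cinner (x + y) z = cinner x z + cinner y z"
    and cinner_scaleC_left: "cinner (c *\<^sub>C x) y = c * cinner x y"
    and inner_eq_Re_cinner: "inner x y = Re (cinner x y)"

class complex_hilbert = complex_inner + complete_space

instantiation complex :: complex_hilbert
begin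

definition scaleC_complex :: "complex \<Rightarrow> complex \<Rightarrow> complex"
  where "scaleC_complex c x = c * x"

definition cinner_complex :: "complex \<Rightarrow> complex \<Rightarrow> complex"
  where "cinner_complex x y = x * cnj y"

instance
  by standard
    (simp_all add: scaleC_complex_def cinner_complex_def inner_complex_def algebra_simps
      scaleR_conv_of_real)

end

section \<open>Operators\<close>

definition bounded_clinear :: "('a::complex_inner \<Rightarrow> 'b::complex_inner) \<Rightarrow> bool"
  where "bounded_clinear A \<longleftrightarrow> bounded_linear A \<and> (\<forall>c x. A (c *\<^sub>C x) = c *\<^sub>C A x)"

text \<open>
  Invertibility in the algebra of bounded operators; the inverse is then \<^term>\<open>inv A\<close>.
\<close>

definition invertible_op :: "('a::complex_inner \<Rightarrow> 'a) \<Rightarrow> bool"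
  where "invertible_op A \<longleftrightarrow> bounded_clinear A \<and> bij A \<and> bounded_clinear (inv A)"

definition numerical_range :: "('a::complex_inner \<Rightarrow> 'a) \<Rightarrow> complex set"
  where "numerical_range A = {cinner (A x) x | x. norm x = 1}"

definition sector :: "real \<Rightarrow> complex set"
  where "sector \<phi> = {rcis r \<theta> | r \<theta>. 0 \<le> r \<and> \<bar>\<theta>\<bar> \<le> \<phi>}"

text \<open>
  The scalar function \<open>b\<^sub>\<gamma>\<close> and its value at an operator.  The latter is meaningful only when
  \<open>I - cnj \<gamma> w\<close> is invertible, because \<^const>\<open>inv\<close> is total.
\<close>

definition blaschke :: "complex \<Rightarrow> complex \<Rightarrow> complex"
  where "blaschke \<gamma> z = (z - \<gamma>) / (1 - cnj \<gamma> * z)"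

definition blaschke_op :: "complex \<Rightarrow> ('a::complex_inner \<Rightarrow> 'a) \<Rightarrow> 'a \<Rightarrow> 'a"
  where "blaschke_op \<gamma> w = (\<lambda>x. w x - \<gamma> *\<^sub>C x) \<circ> inv (\<lambda>x. x - cnj \<gamma> *\<^sub>C w x)"

definition kappa0 :: real
  where "kappa0 = 276889 / 127200 - 6103 * sqrt 2 / 10600"

end

theory Submission
  imports Defs
begin

text \<open>
  The quotient \<open>b\<^sub>\<alpha>(w) b\<^sub>\<beta>(w)\<close> has numerator \<open>w\<^sup>2 - (\<alpha> + \<beta>) w + \<alpha>\<beta>\<close> and denominator
  \<open>1 - (cnj \<alpha> + cnj \<beta>) w + cnj \<alpha> cnj \<beta> w\<^sup>2\<close>.  The triangle inequality bounds the first from above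
  and the second from below as soon as norms of \<open>w\<close> and \<open>w\<^sup>2\<close> are known
  (\<open>onorm_blaschke_product\<close>); with \<open>\<parallel>w\<parallel> \<le> \<surd>2\<close> and \<open>\<parallel>w\<^sup>2\<parallel> \<le> \<kappa>\<^sub>0\<close> the result is the stated
  quotient.  So everything rests on two operator inequalities, and the second one is proved
  here with the constant \<open>\<surd>(8/5) < \<kappa>\<^sub>0\<close> (\<open>cayley_square\<close>).

  For \<open>x = (T\<^sup>2 + I) y\<close> one has \<open>w x = (T\<^sup>2 - I) y\<close>, so the inequalities compare norms of
  polynomials in \<open>T\<close> applied to one vector.  The hypothesis says that \<open>Re \<langle>(1 \<plusminus> i) T u, u\<rangle> \<ge> 0\<close> for
  all \<open>u\<close>.  Taking \<open>u = p + iq\<close> with one sign and \<open>u = p - iq\<close> with the other and adding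
  eliminates all imaginary parts and leaves, for the real inner product,
  \<open>G(p, q) = \<langle>Tp, p + q\<rangle> + \<langle>Tq, q - p\<rangle> \<ge> 0\<close> (\<open>quarter_sectorial\<close>).  Both bounds are now
  certificates, identities that exhibit the required difference as a square plus nonnegative
  multiples of values of \<open>G\<close>:
  \<open>2 \<parallel>(T\<^sup>2+I)x\<parallel>\<^sup>2 - \<parallel>(T\<^sup>2-I)x\<parallel>\<^sup>2 = \<parallel>(T-I)\<^sup>2x\<parallel>\<^sup>2 + 4 G(x, -Tx)\<close> and
  \<open>8 \<parallel>(T\<^sup>2+I)\<^sup>2x\<parallel>\<^sup>2 - 5 \<parallel>(T\<^sup>2-I)\<^sup>2x\<parallel>\<^sup>2 = 3 \<parallel>(T-I)\<^sup>4x\<parallel>\<^sup>2 + 8 G(p, q) + 8 G(p', q')\<close>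
  with \<open>p, q, p', q'\<close> in the span of \<open>x, Tx, T\<^sup>2x, T\<^sup>3x\<close> (\<open>square_inequality\<close>,
  \<open>fourth_power_inequality\<close>).

  The first certificate also bounds \<open>T\<^sup>2 + s\<close> below by a multiple of \<open>s\<close>, uniformly in \<open>s > 0\<close>.
  Invertibility, which is clear for large \<open>s\<close>, therefore survives halving \<open>s\<close> and
  propagates to \<open>s = 1\<close> (\<open>invertible_square_plus\<close>).
\<close>

section \<open>Complex-linear bounded operators\<close>

lemma cinner_add_right: "cinner x (y + z) = cinner x y + cinner x (z::'a::complex_inner)"
  by (metis cinner_add_left cinner_commute complex_cnj_add)

lemma cinner_zero_left: "cinner 0 (x::'a::complex_inner) = 0"
  using cinner_add_left[of 0 0 x] by simp

lemma cinner_scaleC_right: "cinner x (c *\<^sub>C y) = cnj c * cinner x (y::'a::complex_inner)"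
  by (metis cinner_commute cinner_scaleC_left complex_cnj_mult)

lemma norm_scaleC: "norm (c *\<^sub>C x) = cmod c * norm (x::'a::complex_inner)"
proof -
  have "inner (c *\<^sub>C x) (c *\<^sub>C x) = (cmod c)\<^sup>2 * inner x x"
    by (simp add: inner_eq_Re_cinner cinner_scaleC_left cinner_scaleC_right cmod_power2
        power2_eq_square[of "Re c"] power2_eq_square[of "Im c"] algebra_simps)
  then show ?thesis
    by (simp add: norm_eq_sqrt_inner real_sqrt_mult)
qed

lemma bounded_linear_scaleC: "bounded_linear (\<lambda>x::'a::complex_inner. c *\<^sub>C x)"
proof (rule bounded_linear_intro)
  show "c *\<^sub>C (r *\<^sub>R x) = r *\<^sub>R c *\<^sub>C x" for r and x :: 'a
    by (simp add: scaleR_scaleC scaleC_scaleC mult.commute)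
  show "norm (c *\<^sub>C x) \<le> norm x * cmod c" for x :: 'a
    by (simp add: norm_scaleC mult.commute)
qed (rule scaleC_add_right)

lemmas scaleC_diff_right = linear_diff[OF bounded_linear.linear[OF bounded_linear_scaleC]]

lemma bounded_clinear_ident: "bounded_clinear (\<lambda>x. x)"
  by (simp add: bounded_clinear_def)

lemma bounded_clinear_scaleC: "bounded_clinear A \<Longrightarrow> bounded_clinear (\<lambda>x. c *\<^sub>C A x)"
  by (auto simp: bounded_clinear_def scaleC_scaleC mult.commute
      intro: bounded_linear_compose[OF bounded_linear_scaleC])

lemma bounded_clinear_add:
  "bounded_clinear A \<Longrightarrow> bounded_clinear B \<Longrightarrow> bounded_clinear (\<lambda>x. A x + B x)"
  by (auto simp: bounded_clinear_def scaleC_add_right intro: bounded_linear_add)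

lemma bounded_clinear_diff:
  "bounded_clinear A \<Longrightarrow> bounded_clinear B \<Longrightarrow> bounded_clinear (\<lambda>x. A x - B x)"
  by (auto simp: bounded_clinear_def scaleC_diff_right intro: bounded_linear_sub)

lemma bounded_clinear_compose:
  "bounded_clinear A \<Longrightarrow> bounded_clinear B \<Longrightarrow> bounded_clinear (\<lambda>x. A (B x))"
  by (auto simp: bounded_clinear_def intro: bounded_linear_compose)

lemma invertible_opI:
  assumes A: "bounded_clinear A" and "c > 0" and below: "\<And>x. c * norm x \<le> norm (A x)"
    and "surj A"
  shows "invertible_op A"
proof -
  interpret bounded_linear A using A by (simp add: bounded_clinear_def)
  have "inj A"
  proof (rule injI)
    fix x y assume "A x = A y"
    then have "c * norm (x - y) \<le> 0" using below[of "x - y"] by (simp add: diff)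
    with \<open>c > 0\<close> show "x = y" by (simp add: mult_le_0_iff)
  qed
  have A_inv: "A (inv A y) = y" for y using \<open>surj A\<close> by (rule surj_f_inv_f)
  have inv_eq: "inv A y = x" if "A x = y" for x y using \<open>inj A\<close> that by auto
  have "bounded_linear (inv A)"
  proof (rule bounded_linear_intro)
    show "inv A (x + y) = inv A x + inv A y" for x y by (rule inv_eq) (simp add: add A_inv)
    show "inv A (r *\<^sub>R x) = r *\<^sub>R inv A x" for r x by (rule inv_eq) (simp add: scaleR A_inv)
    show "norm (inv A y) \<le> norm y * (1 / c)" for y
      using below[of "inv A y"] \<open>c > 0\<close> by (simp add: A_inv field_simps)
  qed
  moreover have "inv A (k *\<^sub>C x) = k *\<^sub>C inv A x" for k x
    by (rule inv_eq) (use A in \<open>simp add: bounded_clinear_def A_inv\<close>)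
  ultimately show ?thesis
    using A \<open>inj A\<close> \<open>surj A\<close> by (simp add: invertible_op_def bounded_clinear_def bij_def)
qed

text \<open>
  Neumann series in fixed point form: \<open>A x + D x = y\<close> says \<open>x = A\<inverse> (y - D x)\<close>, and this map is a
  contraction with factor \<open>d / c\<close>.
\<close>

lemma surj_perturb:
  fixes A D :: "'a::{real_normed_vector,complete_space} \<Rightarrow> 'a"
  assumes A: "linear A" and "surj A" and below: "\<And>x. c * norm x \<le> norm (A x)"
    and D: "linear D" and above: "\<And>x. norm (D x) \<le> d * norm x" and "0 \<le> d" "d < c"
  shows "surj (\<lambda>x. A x + D x)"
proof -
  have "\<exists>x. A x + D x = y" for y
  proof -
    define g where "g x = inv A (y - D x)" for x
    have A_g: "A (g x) = y - D x" for x
      unfolding g_def using \<open>surj A\<close> by (rule surj_f_inv_f)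
    have "dist (g x) (g z) \<le> d / c * dist x z" for x z
    proof -
      have "c * norm (g x - g z) \<le> norm (D (z - x))"
        using below[of "g x - g z"] by (simp add: linear_diff[OF A] linear_diff[OF D] A_g)
      also have "\<dots> \<le> d * norm (z - x)" by (rule above)
      finally show ?thesis
        using \<open>0 \<le> d\<close> \<open>d < c\<close> by (simp add: dist_norm field_simps norm_minus_commute)
    qed
    then have "\<exists>!x. x \<in> UNIV \<and> g x = x"
      using \<open>0 \<le> d\<close> \<open>d < c\<close> by (simp add: banach_fix_type[of "d / c"])
    then obtain x where "g x = x" by blast
    then show ?thesis using A_g[of x] by (intro exI[of _ x]) simp
  qed
  then show ?thesis by (metis surjI)
qed

section \<open>The sector condition in real form\<close>

text \<open>
  The form \<open>\<langle>Tp, p + q\<rangle> + \<langle>Tq, q - p\<rangle>\<close> is the mean of \<open>Re \<langle>(1 + i) T(p + iq), p + iq\<rangle>\<close> and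
  \<open>Re \<langle>(1 - i) T(p - iq), p - iq\<rangle>\<close>.  Only the real inner product occurs in it, so that
  the certificates below are identities between real bilinear forms.
\<close>

definition quarter_sectorial :: "('a::real_inner \<Rightarrow> 'a) \<Rightarrow> bool"
  where "quarter_sectorial T \<longleftrightarrow> (\<forall>p q. 0 \<le> inner (T p) (p + q) + inner (T q) (q - p))"

lemma sector_quarter_pi: "z \<in> sector (pi / 4) \<Longrightarrow> \<bar>Im z\<bar> \<le> Re z"
proof -
  assume "z \<in> sector (pi / 4)"
  then obtain r \<theta> where z: "z = rcis r \<theta>" and "0 \<le> r" and \<theta>: "\<bar>\<theta>\<bar> \<le> pi / 4"
    by (auto simp: sector_def)
  have "cos (pi / 4) \<le> cos \<bar>\<theta>\<bar>" using \<theta> by (intro cos_monotone_0_pi_le) auto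
  moreover have "sin \<bar>\<theta>\<bar> \<le> sin (pi / 4)" using \<theta> by (intro sin_monotone_2pi_le) auto
  moreover have "\<bar>sin \<theta>\<bar> = sin \<bar>\<theta>\<bar>"
    using \<theta> sin_ge_zero[of "\<bar>\<theta>\<bar>"] by (cases "\<theta> \<ge> 0") (auto simp: abs_if)
  moreover have "cos \<bar>\<theta>\<bar> = cos \<theta>" by simp
  ultimately have "\<bar>sin \<theta>\<bar> \<le> cos \<theta>" by (simp add: sin_45 cos_45)
  with \<open>0 \<le> r\<close> show ?thesis
    by (simp add: z Re_rcis Im_rcis abs_mult mult_left_mono)
qed

lemma cinner_sector:
  assumes T: "bounded_clinear T" and W: "numerical_range T \<subseteq> sector (pi / 4)"
  shows "\<bar>Im (cinner (T u) u)\<bar> \<le> Re (cinner (T u) u)"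
proof (cases "u = 0")
  case True
  moreover have "T 0 = 0"
    using T by (simp add: bounded_clinear_def bounded_linear.linear linear_0)
  ultimately show ?thesis by (simp add: cinner_zero_left)
next
  case False
  define v where "v = complex_of_real (1 / norm u) *\<^sub>C u"
  have "norm v = 1" using False by (simp add: v_def norm_scaleC norm_inverse inverse_eq_divide norm_divide)
  then have "\<bar>Im (cinner (T v) v)\<bar> \<le> Re (cinner (T v) v)"
    using W by (intro sector_quarter_pi) (auto simp: numerical_range_def)
  moreover have "cinner (T v) v = complex_of_real ((1 / norm u)\<^sup>2) * cinner (T u) u"
    using T by (simp add: v_def bounded_clinear_def cinner_scaleC_left cinner_scaleC_right power2_eq_square)
  ultimately show ?thesis
    using False by (simp add: abs_mult divide_le_cancel del: of_real_power of_real_divide)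
qed

lemma quarter_sectorialI:
  assumes T: "bounded_clinear T" and W: "numerical_range T \<subseteq> sector (pi / 4)"
  shows "quarter_sectorial T"
  unfolding quarter_sectorial_def
proof (intro allI)
  fix p q
  have lin: "T (x + y) = T x + T y" "T (c *\<^sub>C x) = c *\<^sub>C T x" for c x y
    using T by (auto simp: bounded_clinear_def bounded_linear.axioms(1) linear_add bounded_linear.linear)
  \<comment> \<open>Opposite edges of the sector for \<open>p + iq\<close> and \<open>p - iq\<close>: in the sum of the two inequalities the
    imaginary parts of the diagonal terms cancel.\<close>
  have 1: "Im (cinner (T (p + \<i> *\<^sub>C q)) (p + \<i> *\<^sub>C q)) \<le> Re (cinner (T (p + \<i> *\<^sub>C q)) (p + \<i> *\<^sub>C q))"
    using cinner_sector[OF T W, of "p + \<i> *\<^sub>C q"] by linarith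
  have 2: "- Im (cinner (T (p + (-\<i>) *\<^sub>C q)) (p + (-\<i>) *\<^sub>C q)) \<le> Re (cinner (T (p + (-\<i>) *\<^sub>C q)) (p + (-\<i>) *\<^sub>C q))"
    using cinner_sector[OF T W, of "p + (-\<i>) *\<^sub>C q"] by linarith
  show "0 \<le> inner (T p) (p + q) + inner (T q) (q - p)"
    unfolding inner_add_right inner_diff_right unfolding inner_eq_Re_cinner
    using 1 2
    by (simp add: lin cinner_add_left cinner_add_right cinner_scaleC_left cinner_scaleC_right)
qed

section \<open>Two certificates of positivity\<close>

text \<open>
  With \<open>y = Tx\<close>, \<open>z = T\<^sup>2x\<close> and \<open>s = 1\<close>, the sector condition for \<open>p = x\<close>, \<open>q = -y\<close> reads
  \<open>\<langle>y, x\<rangle> + \<langle>z, y\<rangle> + \<langle>z, x\<rangle> \<ge> \<parallel>y\<parallel>\<^sup>2\<close>.  Four times this, added to \<open>\<parallel>z - 2y + x\<parallel>\<^sup>2 \<ge> 0\<close>, cancels every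
  term that contains \<open>y\<close>.  General \<open>s\<close> is the rescaling of \<open>T\<close> by \<open>1 / \<surd>s\<close>.
\<close>

lemma square_inequality:
  assumes T: "linear T" and S: "quarter_sectorial T" and "0 \<le> s"
  shows "0 \<le> (norm (T (T x)))\<^sup>2 + 6 * s * inner (T (T x)) x + s\<^sup>2 * (norm x)\<^sup>2"
proof -
  define r where "r = sqrt s"
  define y z where "y = T x" and "z = T y"
  have r: "0 \<le> r" "s = r\<^sup>2" using \<open>0 \<le> s\<close> by (auto simp: r_def)
  have "0 \<le> inner (T (r *\<^sub>R x)) (r *\<^sub>R x + (- y)) + inner (T (- y)) (- y - r *\<^sub>R x)"
    using S unfolding quarter_sectorial_def by blast
  then have G: "0 \<le> r * (r * inner y x - inner y y) + inner z y + r * inner z x"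
    unfolding linear_scale[OF T] linear_neg[OF T] y_def[symmetric] z_def[symmetric]
    by (simp add: inner_add_right inner_diff_right algebra_simps)
  have "(norm z)\<^sup>2 + 6 * s * inner z x + s\<^sup>2 * (norm x)\<^sup>2 =
      (norm (z - (2 * r) *\<^sub>R y + r\<^sup>2 *\<^sub>R x))\<^sup>2 +
      4 * r * (r * (r * inner y x - inner y y) + inner z y + r * inner z x)"
    unfolding r(2) power2_norm_eq_inner
    by (simp add: inner_simps inner_commute[of x y] inner_commute[of x z] inner_commute[of y z] power2_eq_square algebra_simps)
  then show ?thesis using G r(1) by (simp flip: y_def z_def)
qed

text \<open>
  The analogue for \<open>w\<^sup>2\<close>.  The vectors \<open>p + iq\<close> and \<open>p' + iq'\<close> are \<open>u(T)x\<close> and \<open>v(T)x\<close> for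
  \<open>u(z) = 1 - (1 - i)z + (3 - 2i)z\<^sup>2 - (1 + i)z\<^sup>3\<close> and its conjugate reversal
  \<open>v(z) = z\<^sup>3 cnj (u(1 / cnj z))\<close>.  They come as a pair because
  replacing \<open>T\<close> by \<open>T\<inverse>\<close> preserves the sector and turns \<open>w\<close> into \<open>-w\<close>, so that the quantity
  to be bounded is symmetric under reversing the coefficients.  The polynomial itself is a
  solution of the semidefinite programme whose unknowns are the Hermitian forms to be
  contributed by the two half-planes \<open>Re ((1 \<plusminus> i) z) \<ge> 0\<close>; with this \<open>u\<close> the remainder is the single
  square \<open>3 \<parallel>(T - I)\<^sup>4x\<parallel>\<^sup>2\<close>.
\<close>

lemma fourth_power_inequality:
  assumes T: "linear T" and S: "quarter_sectorial T"
  defines "U \<equiv> \<lambda>x. T (T x) + x" and "V \<equiv> \<lambda>x. T (T x) - x"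
  shows "5 * (norm (V (V x)))\<^sup>2 \<le> 8 * (norm (U (U x)))\<^sup>2"
proof -
  define x1 x2 x3 x4 where "x1 = T x" "x2 = T x1" "x3 = T x2" "x4 = T x3"
  note x = this[symmetric]
  define G where "G p q = inner (T p) (p + q) + inner (T q) (q - p)" for p q
  have G: "0 \<le> G p q" for p q using S unfolding quarter_sectorial_def G_def by blast
  define p q where "p = x - x1 + 3 *\<^sub>R x2 - x3" and "q = x1 - 2 *\<^sub>R x2 - x3"
  define p' q' where "p' = 3 *\<^sub>R x1 - x - x2 + x3" and "q' = x + 2 *\<^sub>R x1 - x2"
  note T_simps = linear_add[OF T] linear_diff[OF T] linear_scale[OF T] x
  have UU: "U (U x) = x4 + 2 *\<^sub>R x2 + x" and VV: "V (V x) = x4 - 2 *\<^sub>R x2 + x"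
    by (simp_all add: U_def V_def T_simps scaleR_2)
  have Tp: "T p = x1 - x2 + 3 *\<^sub>R x3 - x4" "T q = x2 - 2 *\<^sub>R x3 - x4"
    "T p' = 3 *\<^sub>R x2 - x1 - x3 + x4" "T q' = x1 + 2 *\<^sub>R x2 - x3"
    by (simp_all add: p_def q_def p'_def q'_def T_simps)
  have "8 * (norm (U (U x)))\<^sup>2 - 5 * (norm (V (V x)))\<^sup>2 =
    3 * (norm (x4 - 4 *\<^sub>R x3 + 6 *\<^sub>R x2 - 4 *\<^sub>R x1 + x))\<^sup>2 + 8 * G p q + 8 * G p' q'"
    unfolding UU VV G_def Tp power2_norm_eq_inner
    unfolding p_def q_def p'_def q'_def
    by (simp add: inner_simps inner_commute[of x x1] inner_commute[of x x2]
        inner_commute[of x x3] inner_commute[of x x4] inner_commute[of x1 x2] inner_commute[of x1 x3]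
        inner_commute[of x1 x4] inner_commute[of x2 x3] inner_commute[of x2 x4] inner_commute[of x3 x4])
  then show ?thesis using G[of p q] G[of p' q'] by (smt (verit) zero_le_power2)
qed

section \<open>Invertibility and the Cayley transform of the square\<close>

text \<open>
  Three times \<open>\<parallel>T\<^sup>2x + s x\<parallel>\<^sup>2\<close> is the nonnegative quantity of \<open>square_inequality\<close> plus
  \<open>2 \<parallel>T\<^sup>2x\<parallel>\<^sup>2 + 2 s\<^sup>2 \<parallel>x\<parallel>\<^sup>2\<close>, which gives the constant \<open>\<surd>(2/3)\<close>; \<open>3/4\<close> is a rational number
  between \<open>1/2\<close>, which the halving argument needs, and \<open>\<surd>(2/3)\<close>.
\<close>

lemma square_plus_bounded_below:
  assumes T: "linear T" and S: "quarter_sectorial T" and "0 \<le> s"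
  shows "3 / 4 * s * norm x \<le> norm (T (T x) + s *\<^sub>R x)"
proof (rule power2_le_imp_le)
  have "(norm (T (T x) + s *\<^sub>R x))\<^sup>2 = (norm (T (T x)))\<^sup>2 + 2 * s * inner (T (T x)) x + s\<^sup>2 * (norm x)\<^sup>2"
    by (simp add: power2_norm_eq_inner inner_simps inner_commute[of x "T (T x)"] power2_eq_square[of s] algebra_simps)
  then have "2 / 3 * (s * norm x)\<^sup>2 \<le> (norm (T (T x) + s *\<^sub>R x))\<^sup>2"
    using square_inequality[OF assms, of x] zero_le_power2[of "norm (T (T x))"]
    unfolding power_mult_distrib by linarith
  moreover have "(3 / 4 * s * norm x)\<^sup>2 = 9 / 16 * (s * norm x)\<^sup>2"
    by (simp add: power2_eq_square)
  ultimately show "(3 / 4 * s * norm x)\<^sup>2 \<le> (norm (T (T x) + s *\<^sub>R x))\<^sup>2"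
    using zero_le_power2[of "s * norm x"] by linarith
qed simp

text \<open>
  The lower bound \<open>3s/4\<close> for \<open>T\<^sup>2 + s\<close> exceeds the size \<open>s/2\<close> of the perturbation that leads to
  \<open>T\<^sup>2 + s/2\<close>, so surjectivity passes from \<open>s\<close> to \<open>s/2\<close>.  For \<open>s = 2\<^sup>N > \<parallel>T\<^sup>2\<parallel>\<close> it holds because
  \<open>T\<^sup>2\<close> is a small perturbation of \<open>s I\<close>.
\<close>

lemma invertible_square_plus:
  fixes T :: "'a::complex_hilbert \<Rightarrow> 'a"
  assumes T: "bounded_clinear T" and S: "quarter_sectorial T"
  shows "invertible_op (\<lambda>x. T (T x) + x)"
proof -
  have bl: "bounded_linear T" using T by (simp add: bounded_clinear_def)
  then have lin: "linear T" by (rule bounded_linear.linear)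
  define U where "U s x = T (T x) + s *\<^sub>R x" for s :: real and x
  have linear_U: "linear (U s)" for s
    by (rule linearI) (simp_all add: U_def linear_add[OF lin] linear_scale[OF lin] algebra_simps)
  have halve: "surj (U (s / 2))" if "surj (U s)" "0 < s" for s
  proof -
    have "surj (\<lambda>x. U s x + (- (s / 2)) *\<^sub>R x)"
      using that square_plus_bounded_below[OF lin S, of s]
      by (intro surj_perturb[where c = "3 / 4 * s" and d = "s / 2"] linear_U linear_scale_self)
         (simp_all add: U_def)
    moreover have "U s x + (- (s / 2)) *\<^sub>R x = U (s / 2) x" for x
      unfolding U_def add.assoc scaleR_left_distrib[symmetric] by simp
    ultimately show ?thesis by simp
  qed
  have bl2: "bounded_linear (\<lambda>x. T (T x))" by (rule bounded_linear_compose[OF bl bl])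
  obtain N where N: "onorm (\<lambda>x. T (T x)) < 2 ^ N"
    using real_arch_pow[of 2] by auto
  have "surj (\<lambda>x. 2 ^ N *\<^sub>R x + T (T x))"
  proof (rule surj_perturb[where c = "2 ^ N" and d = "onorm (\<lambda>x. T (T x))"])
    show "surj (\<lambda>x::'a. (2 ^ N :: real) *\<^sub>R x)"
      by (rule surjI[of _ "\<lambda>x. (1 / 2 ^ N) *\<^sub>R x"]) simp
  qed (use N bl2 onorm_pos_le[OF bl2] onorm[OF bl2] bounded_linear.linear in \<open>auto simp: linear_scale_self\<close>)
  then have "surj (U (2 ^ N))" by (simp add: U_def add.commute)
  then have "surj (U 1)"
  proof (induction N)
    case (Suc N)
    then show ?case using halve[of "2 ^ Suc N"] by simp
  qed simp
  moreover have "bounded_clinear (\<lambda>x. T (T x) + x)"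
    by (rule bounded_clinear_add[OF bounded_clinear_compose[OF T T] bounded_clinear_ident])
  ultimately show ?thesis
    using square_plus_bounded_below[OF lin S, of 1]
    by (intro invertible_opI[where c = "3 / 4"]) (simp_all add: U_def[abs_def])
qed

text \<open>
  Every vector is of the form \<open>U x\<close>, and also \<open>U (U x)\<close>, for \<open>U = T\<^sup>2 + I\<close>; on such vectors \<open>w\<close> and \<open>w\<^sup>2\<close>
  act as \<open>V\<close> and \<open>V\<^sup>2\<close> for \<open>V = T\<^sup>2 - I\<close>, which commutes with \<open>U\<close>.
\<close>

lemma cayley_square:
  fixes T w :: "'a::complex_hilbert \<Rightarrow> 'a"
  assumes T: "bounded_clinear T" and S: "quarter_sectorial T"
    and w: "w = (\<lambda>x. T (T x) - x) \<circ> inv (\<lambda>x. T (T x) + x)"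
  shows "bounded_clinear w"
    and "norm (w y) \<le> sqrt 2 * norm y"
    and "norm (w (w y)) \<le> sqrt (8 / 5) * norm y"
proof -
  define U V where "U x = T (T x) + x" and "V x = T (T x) - x" for x
  have bl: "bounded_linear T" using T by (simp add: bounded_clinear_def)
  then have lin: "linear T" by (rule bounded_linear.linear)
  have inv_U: "invertible_op U"
    using invertible_square_plus[OF T S] by (simp add: U_def[abs_def])
  then have bij: "bij U" by (simp add: invertible_op_def)
  have w_def: "w y = V (inv U y)" for y
    by (simp add: w U_def[abs_def] V_def[abs_def])
  have w_U: "w (U x) = V x" for x
    using bij by (simp add: w_def bij_is_inj)
  have surj: "\<exists>x. y = U x" for y
    using bij by (metis bij_is_surj surjD)
  have "bounded_clinear V"
    unfolding V_def[abs_def]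
    by (rule bounded_clinear_diff[OF bounded_clinear_compose[OF T T] bounded_clinear_ident])
  then have "bounded_clinear (\<lambda>y. V (inv U y))"
    by (rule bounded_clinear_compose) (use inv_U in \<open>simp add: invertible_op_def\<close>)
  then show "bounded_clinear w" by (simp add: w_def[abs_def])
  show "norm (w y) \<le> sqrt 2 * norm y"
  proof (rule power2_le_imp_le)
    obtain x where y: "y = U x" using surj by blast
    have "(norm (V x))\<^sup>2 \<le> 2 * (norm (U x))\<^sup>2"
      using square_inequality[OF lin S, of 1 x]
      by (simp add: U_def V_def power2_norm_eq_inner inner_simps inner_commute[of x "T (T x)"])
    then show "(norm (w y))\<^sup>2 \<le> (sqrt 2 * norm y)\<^sup>2"
      by (simp add: y w_U power_mult_distrib)
  qed simp
  show "norm (w (w y)) \<le> sqrt (8 / 5) * norm y"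
  proof (rule power2_le_imp_le)
    obtain x where y: "y = U (U x)" using surj by metis
    have "V (U x) = U (V x)"
      by (simp add: U_def V_def linear_add[OF lin] linear_diff[OF lin])
    then have "w (w y) = V (V x)" by (simp add: y w_U)
    moreover have "5 * (norm (V (V x)))\<^sup>2 \<le> 8 * (norm (U (U x)))\<^sup>2"
      using fourth_power_inequality[OF lin S] by (simp add: U_def V_def)
    ultimately show "(norm (w (w y)))\<^sup>2 \<le> (sqrt (8 / 5) * norm y)\<^sup>2"
      by (simp add: y power_mult_distrib)
  qed simp
qed

section \<open>Blaschke products of an operator\<close>

lemma invertible_resolvent:
  fixes w :: "'a::complex_hilbert \<Rightarrow> 'a"
  assumes w: "bounded_clinear w" and bound: "\<And>x. norm (w x) \<le> M * norm x"
    and "0 \<le> M" and small: "cmod c * M < 1"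
  shows "invertible_op (\<lambda>x. x - c *\<^sub>C w x)"
proof -
  have clin: "bounded_clinear (\<lambda>x. x - c *\<^sub>C w x)"
    by (rule bounded_clinear_diff[OF bounded_clinear_ident bounded_clinear_scaleC[OF w]])
  have cw: "norm (c *\<^sub>C w x) \<le> cmod c * M * norm x" for x
    using mult_left_mono[OF bound[of x], of "cmod c"] by (simp add: norm_scaleC mult.assoc)
  have "linear (\<lambda>x. (- c) *\<^sub>C w x)"
    using bounded_clinear_scaleC[OF w, of "- c"] by (simp add: bounded_clinear_def bounded_linear.linear)
  moreover have minus: "(- c) *\<^sub>C x = - (c *\<^sub>C x)" for x :: 'a
    using scaleC_scaleC[of "-1" c x] scaleR_scaleC[of "-1" "c *\<^sub>C x"] by simp
  ultimately have "surj (\<lambda>x. x + - (c *\<^sub>C w x))"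
    using cw small \<open>0 \<le> M\<close>
    by (intro surj_perturb[where c = 1 and d = "cmod c * M"]) (auto simp: linear_id[unfolded id_def])
  moreover have "(1 - cmod c * M) * norm x \<le> norm (x - c *\<^sub>C w x)" for x
    using norm_triangle_ineq2[of x "c *\<^sub>C w x"] cw[of x] by (simp add: algebra_simps)
  ultimately show ?thesis
    using clin small by (intro invertible_opI[where c = "1 - cmod c * M"]) auto
qed

text \<open>
  All factors commute, so on \<open>y = (I - cnj \<beta> w)(I - cnj \<alpha> w) x\<close> the product acts as
  \<open>(w - \<alpha>)(w - \<beta>) x\<close>, and it suffices to compare both vectors with \<open>\<parallel>x\<parallel>\<close>.
  Expanding before estimating makes the bound depend on \<open>\<parallel>w\<^sup>2\<parallel> \<le> K\<close>; estimating the two factors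
  separately would only see \<open>\<parallel>w\<parallel>\<^sup>2\<close>.
\<close>

lemma onorm_blaschke_product:
  fixes w :: "'a::complex_hilbert \<Rightarrow> 'a"
  assumes w: "bounded_clinear w"
    and M: "\<And>x. norm (w x) \<le> M * norm x" and "0 \<le> M"
    and K: "\<And>x. norm (w (w x)) \<le> K * norm x" and "0 \<le> K"
    and \<alpha>: "cmod \<alpha> \<le> \<epsilon>" and \<beta>: "cmod \<beta> \<le> \<epsilon>"
    and "\<epsilon> * M < 1" and pos: "0 < 1 - 2 * M * \<epsilon> - K * \<epsilon>\<^sup>2"
  shows "onorm (blaschke_op \<alpha> w \<circ> blaschke_op \<beta> w)
    \<le> (K + 2 * M * \<epsilon> + \<epsilon>\<^sup>2) / (1 - 2 * M * \<epsilon> - K * \<epsilon>\<^sup>2)"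
proof (rule onorm_bound)
  have "0 \<le> \<epsilon>" using \<alpha> norm_ge_zero order_trans by blast
  then show "0 \<le> (K + 2 * M * \<epsilon> + \<epsilon>\<^sup>2) / (1 - 2 * M * \<epsilon> - K * \<epsilon>\<^sup>2)"
    using pos \<open>0 \<le> M\<close> \<open>0 \<le> K\<close> by simp
  define R where "R \<gamma> x = x - cnj \<gamma> *\<^sub>C w x" for \<gamma> x
  define N where "N \<gamma> x = w x - \<gamma> *\<^sub>C x" for \<gamma> x
  have w_simps: "w (a - b) = w a - w b" "w (c *\<^sub>C a) = c *\<^sub>C w a" for a b c
    using w by (auto simp: bounded_clinear_def linear_diff bounded_linear.linear)
  have inv_R: "invertible_op (R \<gamma>)" if "cmod \<gamma> \<le> \<epsilon>" for \<gamma>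
  proof -
    have "cmod (cnj \<gamma>) * M < 1"
      using mult_right_mono[OF that \<open>0 \<le> M\<close>] \<open>\<epsilon> * M < 1\<close> by simp
    then show ?thesis
      unfolding R_def by (intro invertible_resolvent[OF w M \<open>0 \<le> M\<close>])
  qed
  have b_R: "blaschke_op \<gamma> w (R \<gamma> x) = N \<gamma> x" if "cmod \<gamma> \<le> \<epsilon>" for \<gamma> x
    using inv_R[OF that]
    by (simp add: blaschke_op_def invertible_op_def bij_is_inj N_def flip: R_def)
  have cw: "norm (c *\<^sub>C w x) \<le> \<epsilon> * M * norm x" if "cmod c \<le> \<epsilon>" for c x
    using mult_mono[OF that M[of x]] \<open>0 \<le> \<epsilon>\<close> by (simp add: norm_scaleC mult.assoc)
  have cc: "norm ((a * b) *\<^sub>C x) \<le> \<epsilon>\<^sup>2 * norm x" if "cmod a \<le> \<epsilon>" "cmod b \<le> \<epsilon>" for a b and x :: 'a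
    using mult_mono[OF that] \<open>0 \<le> \<epsilon>\<close>
    by (simp add: norm_scaleC norm_mult power2_eq_square mult_right_mono)
  fix y
  obtain x where y: "y = R \<beta> (R \<alpha> x)"
    using inv_R[OF \<alpha>] inv_R[OF \<beta>] unfolding invertible_op_def by (metis bij_is_surj surjD)
  have comm: "N \<beta> (R \<alpha> x) = R \<alpha> (N \<beta> x)"
    by (simp add: N_def R_def w_simps scaleC_diff_right scaleC_scaleC mult.commute)
  have "(blaschke_op \<alpha> w \<circ> blaschke_op \<beta> w) y = N \<alpha> (N \<beta> x)"
    by (simp add: y b_R \<alpha> \<beta> comm)
  also have "\<dots> = w (w x) - \<beta> *\<^sub>C w x - \<alpha> *\<^sub>C w x + (\<alpha> * \<beta>) *\<^sub>C x"
    by (simp add: N_def w_simps scaleC_diff_right scaleC_scaleC)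
  also have "norm \<dots> \<le> norm (w (w x)) + norm (\<beta> *\<^sub>C w x) + norm (\<alpha> *\<^sub>C w x) + norm ((\<alpha> * \<beta>) *\<^sub>C x)"
    by norm
  also have "\<dots> \<le> K * norm x + \<epsilon> * M * norm x + \<epsilon> * M * norm x + \<epsilon>\<^sup>2 * norm x"
    using K cw[OF \<alpha>] cw[OF \<beta>] cc[OF \<alpha> \<beta>] by (intro add_mono)
  finally have num: "norm ((blaschke_op \<alpha> w \<circ> blaschke_op \<beta> w) y) \<le> (K + 2 * M * \<epsilon> + \<epsilon>\<^sup>2) * norm x"
    by (simp add: algebra_simps)
  have "x = y + cnj \<alpha> *\<^sub>C w x + cnj \<beta> *\<^sub>C w x - (cnj \<alpha> * cnj \<beta>) *\<^sub>C w (w x)"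
    by (simp add: y R_def w_simps scaleC_diff_right scaleC_scaleC mult.commute)
  also have "norm \<dots> \<le> norm y + norm (cnj \<alpha> *\<^sub>C w x) + norm (cnj \<beta> *\<^sub>C w x) + norm ((cnj \<alpha> * cnj \<beta>) *\<^sub>C w (w x))"
    by norm
  finally have "norm x \<le> norm y + norm (cnj \<alpha> *\<^sub>C w x) + norm (cnj \<beta> *\<^sub>C w x) + norm ((cnj \<alpha> * cnj \<beta>) *\<^sub>C w (w x))" .
  moreover have "norm ((cnj \<alpha> * cnj \<beta>) *\<^sub>C w (w x)) \<le> \<epsilon>\<^sup>2 * (K * norm x)"
    using cc[of "cnj \<alpha>" "cnj \<beta>" "w (w x)"] \<alpha> \<beta> mult_left_mono[OF K[of x], of "\<epsilon>\<^sup>2"] by simp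
  ultimately have den: "(1 - 2 * M * \<epsilon> - K * \<epsilon>\<^sup>2) * norm x \<le> norm y"
    using cw[of "cnj \<alpha>" x] cw[of "cnj \<beta>" x] \<alpha> \<beta> by (simp add: algebra_simps)
  show "norm ((blaschke_op \<alpha> w \<circ> blaschke_op \<beta> w) y)
    \<le> (K + 2 * M * \<epsilon> + \<epsilon>\<^sup>2) / (1 - 2 * M * \<epsilon> - K * \<epsilon>\<^sup>2) * norm y"
  proof -
    have "norm x \<le> norm y / (1 - 2 * M * \<epsilon> - K * \<epsilon>\<^sup>2)"
      using den pos by (simp add: pos_le_divide_eq mult.commute)
    from order_trans[OF num mult_left_mono[OF this]] show ?thesis
      using \<open>0 \<le> M\<close> \<open>0 \<le> K\<close> \<open>0 \<le> \<epsilon>\<close> by simp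
  qed
qed

section \<open>The numerical constants\<close>

lemma sqrt_2_bounds: "707 / 500 < sqrt 2" "sqrt 2 < 283 / 200"
proof -
  show "707 / 500 < sqrt 2" by (rule real_less_rsqrt) (simp add: power2_eq_square)
  show "sqrt 2 < 283 / 200" by (rule real_less_lsqrt) (simp_all add: power2_eq_square)
qed

lemma sqrt_8_5_le_kappa0: "sqrt (8 / 5) \<le> kappa0"
proof -
  have "sqrt (8 / 5) \<le> 1.3" by (rule real_le_lsqrt) (simp_all add: power2_eq_square)
  also have "1.3 \<le> kappa0" using sqrt_2_bounds by (simp add: kappa0_def)
  finally show ?thesis .
qed

lemma kappa0_denominator_pos: "0 < 1 - 2 * sqrt 2 / 150 - kappa0 / 150\<^sup>2"
  using sqrt_2_bounds by (simp add: kappa0_def)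

text \<open>
  After multiplication by the denominator both sides are linear in \<open>\<surd>2\<close>, and the inequality
  asks for \<open>\<surd>2\<close> to exceed a rational number near \<open>1.4104\<close>.
\<close>

lemma kappa0_quotient_less_sqrt_2:
  "(kappa0 + 2 * sqrt 2 / 150 + 1 / 150\<^sup>2) / (1 - 2 * sqrt 2 / 150 - kappa0 / 150\<^sup>2) < sqrt 2"
proof -
  have "sqrt 2 * (1 - 2 * sqrt 2 / 150 - kappa0 / 150\<^sup>2)
    = sqrt 2 - 4 / 150 - sqrt 2 * kappa0 / 150\<^sup>2"
    by (simp add: right_diff_distrib)
  also have "sqrt 2 * kappa0 = 276889 / 127200 * sqrt 2 - 6103 * 2 / 10600"
    by (simp add: kappa0_def algebra_simps)
  finally have eq: "sqrt 2 * (1 - 2 * sqrt 2 / 150 - kappa0 / 150\<^sup>2)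
    = sqrt 2 - 4 / 150 - (276889 / 127200 * sqrt 2 - 6103 * 2 / 10600) / 150\<^sup>2" .
  have "kappa0 + 2 * sqrt 2 / 150 + 1 / 150\<^sup>2
    < sqrt 2 - 4 / 150 - (276889 / 127200 * sqrt 2 - 6103 * 2 / 10600) / 150\<^sup>2"
    using sqrt_2_bounds unfolding kappa0_def power2_eq_square by (simp add: field_simps)
  then show ?thesis
    unfolding eq[symmetric] using kappa0_denominator_pos by (simp add: pos_divide_less_eq)
qed

section \<open>Zeros and the boundary of the parameter bidisk\<close>

text \<open>
  No zero of one factor is a pole of the other, because \<open>cnj a * b = 1\<close> is impossible inside the
  unit disk.
\<close>

lemma blaschke_product_zeros:
  assumes "cmod \<alpha> < 1" "cmod \<beta> < 1"
  shows "{z. 1 - cnj \<alpha> * z \<noteq> 0 \<and> 1 - cnj \<beta> * z \<noteq> 0 \<and> blaschke \<alpha> z * blaschke \<beta> z = 0} = {\<alpha>, \<beta>}"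
proof -
  have "1 - cnj a * b \<noteq> 0" if "cmod a < 1" "cmod b < 1" for a b
  proof
    assume "1 - cnj a * b = 0"
    then have "cmod (cnj a * b) = 1" by simp
    moreover have "cmod a * cmod b < 1"
      using that by (metis mult_strict_mono' norm_ge_zero mult_1)
    ultimately show False by (simp add: norm_mult)
  qed
  with assms show ?thesis by (auto simp: blaschke_def)
qed

lemma frontier_bidisk:
  fixes \<alpha> \<beta> :: complex
  assumes "cmod \<alpha> = r" "cmod \<beta> \<le> r"
  shows "(\<alpha>, \<beta>) \<in> frontier {(a, b). cmod a \<le> r \<and> cmod b \<le> r}"
proof -
  have "{(a, b). cmod a \<le> r \<and> cmod b \<le> r} = cball 0 r \<times> cball 0 r"
    by (auto simp: dist_norm)
  then show ?thesis
    using assms by (simp add: frontier_def closure_Times interior_Times)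
qed

theorem theorem1p10:
  fixes T w :: "'a::complex_hilbert \<Rightarrow> 'a" and B :: real
  assumes T: "bounded_clinear T"
    and W: "numerical_range T \<subseteq> sector (pi / 4)"
    and w: "w = (\<lambda>x. T (T x) - x) \<circ> inv (\<lambda>x. T (T x) + x)"
    and B: "B = (kappa0 + 2 * sqrt 2 / 150 + 1 / 150\<^sup>2) / (1 - 2 * sqrt 2 / 150 - kappa0 / 150\<^sup>2)"
  shows "invertible_op (\<lambda>x. T (T x) + x) \<and>
    (\<forall>\<alpha> \<beta>. cmod \<alpha> \<le> 1 / 150 \<and> cmod \<beta> \<le> 1 / 150 \<longrightarrow>
      invertible_op (\<lambda>x. x - cnj \<alpha> *\<^sub>C w x) \<and>
      invertible_op (\<lambda>x. x - cnj \<beta> *\<^sub>C w x) \<and>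
      onorm (blaschke_op \<alpha> w \<circ> blaschke_op \<beta> w) \<le> B) \<and>
    B < sqrt 2 \<and>
    (let \<alpha> = 1 / 150; \<beta> = \<i> / 150 in
      onorm (blaschke_op \<alpha> w \<circ> blaschke_op \<beta> w) \<le> B \<and>
      \<alpha> \<noteq> \<beta> \<and> \<alpha> \<noteq> 0 \<and> \<beta> \<noteq> 0 \<and>
      {z. 1 - cnj \<alpha> * z \<noteq> 0 \<and> 1 - cnj \<beta> * z \<noteq> 0 \<and> blaschke \<alpha> z * blaschke \<beta> z = 0} = {\<alpha>, \<beta>} \<and>
      (\<alpha>, \<beta>) \<in> frontier {(a, b). cmod a \<le> 1 / 150 \<and> cmod b \<le> 1 / 150})"
proof -
  have S: "quarter_sectorial T" by (rule quarter_sectorialI[OF T W])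
  note w_bounds = cayley_square[OF T S w]
  have K: "norm (w (w x)) \<le> kappa0 * norm x" for x
    using w_bounds(3)[of x] mult_right_mono[OF sqrt_8_5_le_kappa0, of "norm x"] by simp
  have "0 \<le> sqrt (8 / 5 :: real)" by simp
  then have kappa0: "0 \<le> kappa0" using sqrt_8_5_le_kappa0 by linarith
  have small: "c * sqrt 2 < 1" if "c \<le> 1 / 150" for c
  proof -
    have "c * sqrt 2 \<le> 1 / 150 * sqrt 2" using that by (intro mult_right_mono) simp_all
    then show ?thesis using sqrt_2_bounds by linarith
  qed
  have bound: "onorm (blaschke_op \<alpha> w \<circ> blaschke_op \<beta> w) \<le> B"
    if "cmod \<alpha> \<le> 1 / 150" "cmod \<beta> \<le> 1 / 150" for \<alpha> \<beta>
    using onorm_blaschke_product[OF w_bounds(1,2) _ K kappa0 that] kappa0_denominator_pos small[of "1 / 150"]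
    by (simp add: B power_divide)
  have resolvent: "invertible_op (\<lambda>x. x - cnj \<gamma> *\<^sub>C w x)" if "cmod \<gamma> \<le> 1 / 150" for \<gamma>
    using small[OF that] by (intro invertible_resolvent[OF w_bounds(1,2)]) simp_all
  have norms: "cmod (1 / 150) = 1 / 150" "cmod (\<i> / 150) = 1 / 150"
    by (simp_all add: norm_divide)
  have "B < sqrt 2" unfolding B by (rule kappa0_quotient_less_sqrt_2)
  moreover have "1 / 150 \<noteq> \<i> / 150" by (simp add: complex_eq_iff)
  moreover have "{z. 1 - cnj (1 / 150) * z \<noteq> 0 \<and> 1 - cnj (\<i> / 150) * z \<noteq> 0 \<and>
      blaschke (1 / 150) z * blaschke (\<i> / 150) z = 0} = {1 / 150, \<i> / 150}"
    by (rule blaschke_product_zeros) (simp_all add: norm_divide)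
  moreover have "(1 / 150, \<i> / 150) \<in> frontier {(a, b). cmod a \<le> 1 / 150 \<and> cmod b \<le> 1 / 150}"
    by (rule frontier_bidisk) (simp_all only: norms)
  moreover have "onorm (blaschke_op (1 / 150) w \<circ> blaschke_op (\<i> / 150) w) \<le> B"
    by (rule bound) (simp_all only: norms)
  moreover have "(1 / 150 :: complex) \<noteq> 0" "\<i> / 150 \<noteq> 0" by simp_all
  ultimately show ?thesis
    unfolding Let_def using invertible_square_plus[OF T S] bound resolvent by blast
qed

end
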